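(* Let $\mathcal{H}$ be a real finite-dimensional Hilbert space and $A$ a self-adjoint positive definite linear operator on $\mathcal{H}$. Let $J\ge 1$, let $\mathcal{H}_k$, $k=0,1,\ldots,J$, be real finite-dimensional Hilbert spaces, and let $I_k:\mathcal{H}_k\to\mathcal{H}$ and $I^k:\mathcal{H}\to\mathcal{H}_k$, $k=0,\ldots,J$, be linear operators such that $\mathrm{null}(I_k)=\{0\}$ for $k=1,\ldots,J$ and $\mathcal{H}=\sum_{k=1}^J I_k\mathcal{H}_k$. Let $R_k,\bar{R}_k$ be linear operators on $\mathcal{H}_k$ for $k=1,\ldots,J$, and let $R_0$ be a linear operator on $\mathcal{H}_0$. Let the linear operator $B$ on $\mathcal{H}$ (the multiplicative domain decomposition operator) be defined implicitly by $$I - BA = (I - I_J \bar{R}_J I^J A)\cdots(I - I_1\bar{R}_1 I^1 A)\,(I - I_0 R_0 I^0 A)\,(I - I_1 R_1 I^1 A)\cdots(I - I_J R_J I^J A).$$ Suppose that 1. $I^k = c_k I_k^T$ with $c_k>0$, for $k=0,\ldots,J$; 2. $\bar{R}_k = R_k^T$ for $k=1,\ldots,J$; 3. $R_0 = R_0^T$; 4. $\left\| \prod_{k=1}^J (I - I_k R_k I^k A) \right\|_A < 1$; 5. $R_0$ is non-negative on $\mathcal{H}_0$. Then $B$ is self-adjoint and positive definite on $\mathcal{H}$.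
   Context: All inner products are written $(\cdot,\cdot)$; the inner products on the different spaces need not be related to each other. For a linear operator $N:\mathcal{H}_1'\to\mathcal{H}_2'$ between Hilbert spaces, $N^T:\mathcal{H}_2'\to\mathcal{H}_1'$ is the adjoint defined by $(Nu,v)_{\mathcal{H}_2'}=(u,N^Tv)_{\mathcal{H}_1'}$. An operator $M$ is positive definite if $(Mu,u)>0$ for all $u\ne0$, and non-negative if $(Mu,u)\ge0$ for all $u$. $(u,v)_A=(Au,v)$, $\|u\|_A=(u,u)_A^{1/2}$, and $\|M\|_A$ is the operator norm on $\mathcal{H}$ induced by $\|\cdot\|_A$. In products of operators the first term is on the left: $\prod_{k=1}^J M_k=M_1M_2\cdots M_J$. $I$ is the identity operator. Since $A$ is invertible, the displayed equation determines $B$. *)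

theory Defs
  imports "HOL-Analysis.Analysis" "HOL-Library.Set_Algebras"
begin

(* The spaces H_k have different dimensions and unrelated inner products, so each is given by a
   carrier V inside a real vector space together with its own inner product ip, of which only the
   values on V matter.  A common ambient type is no restriction for finitely many spaces: take
   their direct sum.  Linear maps out of such a space are likewise only constrained on V. *)

definition fin_dim :: "'a::real_vector set \<Rightarrow> bool" where
  "fin_dim V \<longleftrightarrow> (\<exists>F. finite F \<and> span F = V)"

definition inner_product_on :: "'a::real_vector set \<Rightarrow> ('a \<Rightarrow> 'a \<Rightarrow> real) \<Rightarrow> bool" where
  "inner_product_on V ip \<longleftrightarrow>
     (\<forall>x\<in>V. \<forall>y\<in>V. ip x y = ip y x) \<and>
     (\<forall>x\<in>V. \<forall>y\<in>V. \<forall>z\<in>V. ip (x + y) z = ip x z + ip y z) \<and>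
     (\<forall>a. \<forall>x\<in>V. \<forall>y\<in>V. ip (a *\<^sub>R x) y = a * ip x y) \<and>
     (\<forall>x\<in>V. x \<noteq> 0 \<longrightarrow> 0 < ip x x)"

(* Completeness is automatic in finite dimension. *)
definition fin_dim_hilbert :: "'a::real_vector set \<Rightarrow> ('a \<Rightarrow> 'a \<Rightarrow> real) \<Rightarrow> bool" where
  "fin_dim_hilbert V ip \<longleftrightarrow> subspace V \<and> fin_dim V \<and> inner_product_on V ip"

definition linear_betw ::
    "'a::real_vector set \<Rightarrow> 'b::real_vector set \<Rightarrow> ('a \<Rightarrow> 'b) \<Rightarrow> bool" where
  "linear_betw V W f \<longleftrightarrow>
     (\<forall>x\<in>V. f x \<in> W) \<and>
     (\<forall>x\<in>V. \<forall>y\<in>V. f (x + y) = f x + f y) \<and>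
     (\<forall>a. \<forall>x\<in>V. f (a *\<^sub>R x) = a *\<^sub>R f x)"

(* adjoint_on V ipV ipW N is N^T for N from (V, ipV) to (W, ipW); it is meaningful on W only. *)
definition adjoint_on ::
    "'a set \<Rightarrow> ('a \<Rightarrow> 'a \<Rightarrow> real) \<Rightarrow> ('b \<Rightarrow> 'b \<Rightarrow> real) \<Rightarrow> ('a \<Rightarrow> 'b) \<Rightarrow> 'b \<Rightarrow> 'a" where
  "adjoint_on V ipV ipW N v = (THE w. w \<in> V \<and> (\<forall>u\<in>V. ipW (N u) v = ipV u w))"

definition self_adjoint_on :: "'a set \<Rightarrow> ('a \<Rightarrow> 'a \<Rightarrow> real) \<Rightarrow> ('a \<Rightarrow> 'a) \<Rightarrow> bool" where
  "self_adjoint_on V ip M \<longleftrightarrow> (\<forall>v\<in>V. M v = adjoint_on V ip ip M v)"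

definition pos_def_on :: "'a::zero set \<Rightarrow> ('a \<Rightarrow> 'a \<Rightarrow> real) \<Rightarrow> ('a \<Rightarrow> 'a) \<Rightarrow> bool" where
  "pos_def_on V ip M \<longleftrightarrow> (\<forall>u\<in>V. u \<noteq> 0 \<longrightarrow> 0 < ip (M u) u)"

definition nonneg_on :: "'a set \<Rightarrow> ('a \<Rightarrow> 'a \<Rightarrow> real) \<Rightarrow> ('a \<Rightarrow> 'a) \<Rightarrow> bool" where
  "nonneg_on V ip M \<longleftrightarrow> (\<forall>u\<in>V. 0 \<le> ip (M u) u)"

definition energy_norm :: "('a::real_inner \<Rightarrow> 'a) \<Rightarrow> 'a \<Rightarrow> real" where
  "energy_norm A u = sqrt (A u \<bullet> u)"

(* As for the library's onorm, u = 0 contributes 0 / 0 = 0, so that the supremum is also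
   right on the zero space. *)
definition energy_onorm :: "('a::real_inner \<Rightarrow> 'a) \<Rightarrow> ('a \<Rightarrow> 'a) \<Rightarrow> real" where
  "energy_onorm A M = (SUP u. energy_norm A (M u) / energy_norm A u)"

(* The first factor stands on the left, i.e. is applied last. *)
definition op_prod :: "('a \<Rightarrow> 'a) list \<Rightarrow> 'a \<Rightarrow> 'a" where
  "op_prod Ms = foldr (\<circ>) Ms id"

(* I - P R Q A, with P = I_k and Q = I^k. *)
definition correction ::
    "('a::real_vector \<Rightarrow> 'a) \<Rightarrow> ('b \<Rightarrow> 'a) \<Rightarrow> ('b \<Rightarrow> 'b) \<Rightarrow> ('a \<Rightarrow> 'b) \<Rightarrow> 'a \<Rightarrow> 'a" where
  "correction A P R Q u = u - P (R (Q (A u)))"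

(* Riesz representation: the description in adjoint_on denotes. *)

lemma inner_product_onD:
  assumes "inner_product_on V ip" "x \<in> V" "y \<in> V"
  shows "ip x y = ip y x"
    and "z \<in> V \<Longrightarrow> ip (x + y) z = ip x z + ip y z"
    and "ip (a *\<^sub>R x) y = a * ip x y"
    and "x \<noteq> 0 \<Longrightarrow> 0 < ip x x"
  using assms unfolding inner_product_on_def by (meson)+

lemma linear_betwD:
  assumes "linear_betw V W f" "x \<in> V"
  shows "f x \<in> W"
    and "y \<in> V \<Longrightarrow> f (x + y) = f x + f y"
    and "f (a *\<^sub>R x) = a *\<^sub>R f x"
  using assms unfolding linear_betw_def by (meson)+

lemma riesz_span:
  assumes ip: "inner_product_on V ip" and V: "subspace V"
    and F: "finite F" "F \<subseteq> V"
    and \<phi>: "linear_betw V UNIV (\<phi> :: 'a::real_vector \<Rightarrow> real)"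
  shows "\<exists>w\<in>span F. \<forall>u\<in>span F. \<phi> u = ip u w"
  using F \<phi>
proof (induction F arbitrary: \<phi> rule: finite_induct)
  case empty
  have z: "\<psi> 0 = 0" if "linear_betw V UNIV \<psi>" for \<psi> :: "'a \<Rightarrow> real"
  proof -
    have "\<psi> (0 *\<^sub>R 0) = 0 *\<^sub>R \<psi> 0"
      using that subspace_0[OF V] by (rule linear_betwD(3))
    then show ?thesis by simp
  qed
  have "ip (0 *\<^sub>R 0) 0 = 0 * ip 0 0"
    using ip subspace_0[OF V] subspace_0[OF V] by (rule inner_product_onD(3))
  then have "ip 0 0 = 0" by simp
  then show ?case using z[OF empty(2)] by simp
next
  case (insert x F)
  have xV: "x \<in> V" and FV: "F \<subseteq> V" using insert.prems by auto
  have sV: "u \<in> V" if "u \<in> span F" for u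
    using span_minimal[OF FV V] that by auto
  have sym: "ip a b = ip b a" if "a \<in> V" "b \<in> V" for a b
    using ip that by (rule inner_product_onD(1))
  have add: "ip (a + b) d = ip a d + ip b d" if "a \<in> V" "b \<in> V" "d \<in> V" for a b d
    using inner_product_onD(2)[OF ip that] .
  have sc: "ip (r *\<^sub>R a) b = r * ip a b" if "a \<in> V" "b \<in> V" for r a b
    using ip that by (rule inner_product_onD(3))
  have addr: "ip d (a + b) = ip d a + ip d b" if "a \<in> V" "b \<in> V" "d \<in> V" for a b d
    using add[OF that] sym[OF that(1,3)] sym[OF that(2,3)]
      sym[OF subspace_add[OF V that(1,2)] that(3)] by simp
  have scr: "ip b (r *\<^sub>R a) = r * ip b a" if "a \<in> V" "b \<in> V" for r a b
    using sc[OF that] sym[OF that] sym[OF subspace_scale[OF V that(1)] that(2)] by simp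
  have "linear_betw V UNIV (\<lambda>u. ip u x)"
    unfolding linear_betw_def using add sc xV by simp
  from insert.IH[OF FV this] obtain p
    where p: "p \<in> span F" "\<forall>u\<in>span F. ip u x = ip u p" by blast
  from insert.IH[OF FV insert.prems(2)] obtain w0
    where w0: "w0 \<in> span F" "\<forall>u\<in>span F. \<phi> u = ip u w0" by blast
  define e where "e = x - p"
  have pV: "p \<in> V" and w0V: "w0 \<in> V" using p w0 sV by auto
  have eV: "e \<in> V" unfolding e_def using subspace_diff[OF V] xV pV by blast
  have orth: "ip u e = 0" if "u \<in> span F" for u
  proof -
    have "ip u x = ip u e + ip u p"
      using addr[OF eV pV sV[OF that]] by (simp add: e_def)
    then show ?thesis using p(2) that by simp
  qed
  have spanF: "span F \<subseteq> span (insert x F)" by (intro span_mono) auto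
  show ?case
  proof (cases "e = 0")
    case True
    then have "x \<in> span F" using p by (simp add: e_def)
    then have "span (insert x F) = span F" by (rule span_redundant)
    then show ?thesis using w0 by auto
  next
    case False
    then have pos: "0 < ip e e" using inner_product_onD(4)[OF ip eV eV] by blast
    define r where "r = \<phi> e / ip e e"
    define w where "w = w0 + r *\<^sub>R e"
    have "e \<in> span (insert x F)"
      unfolding e_def using p(1) spanF by (intro span_diff) (auto intro: span_base)
    then have "w \<in> span (insert x F)"
      unfolding w_def using w0(1) spanF by (intro span_add span_scale) auto
    moreover have "\<phi> u = ip u w" if uF: "u \<in> span (insert x F)" for u
    proof -
      obtain k where k: "u - k *\<^sub>R x \<in> span F" using uF unfolding span_insert by blast
      define v where "v = u - k *\<^sub>R x + k *\<^sub>R p"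
      have v: "v \<in> span F" unfolding v_def using k p(1) by (intro span_add span_scale)
      have vV: "v \<in> V" using sV[OF v] .
      have u: "u = v + k *\<^sub>R e" by (simp add: v_def e_def algebra_simps)
      have keV: "k *\<^sub>R e \<in> V" "r *\<^sub>R e \<in> V" using subspace_scale[OF V] eV by auto
      have "\<phi> u = \<phi> v + k * \<phi> e"
        unfolding u using linear_betwD(2)[OF insert.prems(2) vV keV(1)]
          linear_betwD(3)[OF insert.prems(2) eV, of k] by simp
      also have "\<dots> = ip v w0 + k * (r * ip e e)"
        using w0(2) v pos by (simp add: r_def)
      also have "\<dots> = ip u w"
        unfolding u w_def
        using vV keV eV w0V subspace_add[OF V] orth[OF v] orth[OF w0(1)] sym[OF eV w0V]
        by (simp add: add addr sc scr)
      finally show ?thesis .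
    qed
    ultimately show ?thesis by blast
  qed
qed

lemma adjoint_on_works:
  assumes V: "fin_dim_hilbert V ipV" and W: "inner_product_on W ipW"
    and N: "linear_betw V W N" and v: "v \<in> W"
  shows "adjoint_on V ipV ipW N v \<in> V"
    and "u \<in> V \<Longrightarrow> ipW (N u) v = ipV u (adjoint_on V ipV ipW N v)"
proof -
  have sub: "subspace V" and ip: "inner_product_on V ipV"
    using V by (auto simp: fin_dim_hilbert_def)
  obtain F where F: "finite F" "span F = V"
    using V by (auto simp: fin_dim_hilbert_def fin_dim_def)
  have "linear_betw V UNIV (\<lambda>u. ipW (N u) v)"
    unfolding linear_betw_def
    using linear_betwD[OF N] inner_product_onD(2,3)[OF W] v by simp
  from riesz_span[OF ip sub F(1) _ this] F(2) span_superset[of F]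
  obtain w where w: "w \<in> V" "\<forall>u\<in>V. ipW (N u) v = ipV u w" by auto
  have uniq: "w' = w" if w': "w' \<in> V" "\<forall>u\<in>V. ipW (N u) v = ipV u w'" for w'
  proof (rule ccontr)
    assume "w' \<noteq> w"
    define d where "d = w' - w"
    have d: "d \<in> V" "d \<noteq> 0"
      using subspace_diff[OF sub] w(1) w'(1) \<open>w' \<noteq> w\<close> by (auto simp: d_def)
    have "ipV (d + w) d = ipV d d + ipV w d"
      using inner_product_onD(2)[OF ip d(1) w(1) d(1)] .
    then have "ipV w' d = ipV d d + ipV w d" by (simp add: d_def)
    moreover have "ipV d w' = ipV d w" using w(2) w'(2) d(1) by simp
    then have "ipV w' d = ipV w d"
      using inner_product_onD(1)[OF ip d(1) w(1)] inner_product_onD(1)[OF ip d(1) w'(1)] by simp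
    moreover have "0 < ipV d d" using inner_product_onD(4)[OF ip d(1) d(1) d(2)] .
    ultimately show False by simp
  qed
  have "adjoint_on V ipV ipW N v = w"
    unfolding adjoint_on_def by (rule the_equality) (use w uniq in blast)+
  then show "adjoint_on V ipV ipW N v \<in> V"
    and "u \<in> V \<Longrightarrow> ipW (N u) v = ipV u (adjoint_on V ipV ipW N v)"
    using w by auto
qed

end

theory Submission
  imports Defs
begin

text \<open>
  Everything is seen through the energy product \<open>(u, v)\<^sub>A = A u \<bullet> v\<close>.  Write \<open>g = I\<^sub>k\<^sup>T A\<close>.  Since
  \<open>I\<^sup>k\<close> is a positive multiple of \<open>I\<^sub>k\<^sup>T\<close>, an operator \<open>S\<close> on the \<open>k\<close>-th space enters the energy
  product of its correction only through the form \<open>(S (g u), g v)\<close>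
  (lemma \<open>energy_correction\<close>).  Hence transposing \<open>S\<close> gives the energy adjoint of the correction,
  and the error operator factors as \<open>I - B A = E\<^sup>* K\<^sub>0 E\<close>, where \<open>E\<close> is the product of the corrections
  with the \<open>R\<^sub>k\<close>, \<open>E\<^sup>*\<close> is its energy adjoint and \<open>K\<^sub>0\<close> is the coarse correction.  Because \<open>R\<^sub>0\<close> is
  symmetric, so is \<open>K\<^sub>0\<close> and with it \<open>I - B A\<close>; because \<open>R\<^sub>0\<close> is non-negative,
  \<open>(K\<^sub>0 w, w)\<^sub>A \<le> (w, w)\<^sub>A\<close> for all \<open>w\<close>, so that for \<open>u \<noteq> 0\<close>
  \<open>((I - B A) u, u)\<^sub>A \<le> (E u, E u)\<^sub>A < (u, u)\<^sub>A\<close> by the contraction hypothesis.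

  That \<open>I - B A\<close> is symmetric in the energy product and lies strictly below the identity says
  exactly that \<open>(B f, h)\<close> is symmetric and positive definite for \<open>f, h\<close> in the range of \<open>A\<close>, and
  \<open>A\<close> is onto (lemma \<open>self_adjoint_pos_def_if_error_small\<close>).

  Beyond the existence of adjoints, finite dimension is used twice, each time through Riesz
  representation in the energy product:
  for the surjectivity of \<open>A\<close>, and to see that the quotients defining \<open>energy_onorm\<close> are bounded.
  The latter is indispensable, since only for a bounded set does the real supremum bound the
  elements.
\<close>

section \<open>The ambient inner product and products of operators\<close>

lemma inner_product_on_inner: "inner_product_on UNIV ((\<bullet>) :: 'a::real_inner \<Rightarrow> 'a \<Rightarrow> real)"
  unfolding inner_product_on_def
  by (intro conjI ballI allI impI) (auto simp: inner_add_left intro: inner_commute)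

lemma linear_op_prod:
  fixes Ms :: "('a::real_vector \<Rightarrow> 'a) list"
  assumes "\<And>M. M \<in> set Ms \<Longrightarrow> linear M"
  shows "linear (op_prod Ms)"
  using assms
proof (induction Ms)
  case Nil
  show ?case by (auto simp: op_prod_def intro!: linearI)
next
  case (Cons M Ms)
  then have "linear (M \<circ> op_prod Ms)" by (intro linear_compose) auto
  then show ?case by (simp add: op_prod_def o_def)
qed

section \<open>The energy product of a symmetric positive definite operator\<close>

locale energy_space =
  fixes A :: "'a::real_inner \<Rightarrow> 'a"
  assumes fin: "fin_dim (UNIV :: 'a set)"
    and lin: "linear A"
    and sym: "A u \<bullet> v = u \<bullet> A v"
    and pos: "u \<noteq> 0 \<Longrightarrow> 0 < A u \<bullet> u"
begin

lemma energy_nonneg: "0 \<le> A u \<bullet> u"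
  using pos[of u] linear_0[OF lin] by (cases "u = 0") auto

lemma energy_commute: "A u \<bullet> v = A v \<bullet> u"
  by (metis sym inner_commute)

lemma energy_norm_square: "(energy_norm A u)\<^sup>2 = A u \<bullet> u"
  by (simp add: energy_norm_def energy_nonneg)

lemma energy_norm_nonneg: "0 \<le> energy_norm A u"
  by (simp add: energy_norm_def energy_nonneg)

lemma energy_norm_pos: "u \<noteq> 0 \<Longrightarrow> 0 < energy_norm A u"
  by (simp add: energy_norm_def pos)

lemma energy_Cauchy_Schwarz: "\<bar>A u \<bullet> v\<bar> \<le> energy_norm A u * energy_norm A v"
proof (cases "v = 0")
  case True
  then show ?thesis by (simp add: energy_norm_nonneg)
next
  case False
  have p: "0 < A v \<bullet> v" using pos[OF False] .
  \<comment> \<open>\<open>t v\<close> is the energy projection of \<open>u\<close> onto the line through \<open>v\<close>.\<close>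
  define t where "t = (A u \<bullet> v) / (A v \<bullet> v)"
  have t: "t * (A v \<bullet> v) = A u \<bullet> v" using p by (simp add: t_def)
  have "0 \<le> A (u - t *\<^sub>R v) \<bullet> (u - t *\<^sub>R v)" by (rule energy_nonneg)
  also have "\<dots> = A u \<bullet> u - 2 * t * (A u \<bullet> v) + t * (t * (A v \<bullet> v))"
    using energy_commute[of v u]
    by (simp add: linear_diff[OF lin] linear_scale[OF lin] inner_diff_left inner_diff_right
        algebra_simps)
  finally have "0 \<le> A u \<bullet> u - t * (A u \<bullet> v)" unfolding t by (simp add: algebra_simps)
  then have "0 \<le> (A u \<bullet> u - t * (A u \<bullet> v)) * (A v \<bullet> v)" using p by simp
  also have "\<dots> = (A u \<bullet> u) * (A v \<bullet> v) - (A u \<bullet> v) * (t * (A v \<bullet> v))"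
    by (simp add: algebra_simps)
  finally have "(A u \<bullet> v)\<^sup>2 \<le> (A u \<bullet> u) * (A v \<bullet> v)"
    unfolding t by (simp add: power2_eq_square)
  then have "\<bar>A u \<bullet> v\<bar>\<^sup>2 \<le> (energy_norm A u * energy_norm A v)\<^sup>2"
    by (simp add: power_mult_distrib energy_norm_square)
  then show ?thesis
    by (rule power2_le_imp_le) (simp add: energy_norm_nonneg)
qed

lemma energy_Riesz:
  fixes \<phi> :: "'a \<Rightarrow> real"
  assumes "linear \<phi>"
  obtains w where "\<And>u. \<phi> u = A u \<bullet> w"
proof -
  obtain F :: "'a set" where F: "finite F" "span F = UNIV"
    using fin by (auto simp: fin_dim_def)
  have "inner_product_on UNIV (\<lambda>u v. A u \<bullet> v)"
    using energy_commute pos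
    by (simp add: inner_product_on_def linear_add[OF lin] linear_scale[OF lin] inner_add_left)
  moreover have "linear_betw UNIV UNIV \<phi>"
    using assms by (simp add: linear_betw_def linear_add linear_scale)
  ultimately show ?thesis
    using riesz_span[of UNIV "\<lambda>u v. A u \<bullet> v" F \<phi>] F that by auto
qed

text \<open>A solution of \<open>A w = f\<close> is the energy representer of the functional \<open>u \<mapsto> u \<bullet> f\<close>.\<close>

lemma surj_A: "surj A"
proof -
  have "\<exists>w. A w = f" for f
  proof -
    have "linear (\<lambda>u. u \<bullet> f)" by (intro linearI) (simp_all add: inner_add_left)
    then obtain w where w: "\<And>u. u \<bullet> f = A u \<bullet> w" using energy_Riesz by blast
    have "u \<bullet> A w = u \<bullet> f" for u using w[of u] sym[of u w] by simp
    then have "A w = f" by (metis vector_eq_rdot inner_commute)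
    then show ?thesis ..
  qed
  then show ?thesis by (metis surj_def)
qed

section \<open>Boundedness of energy quotients and strict contractions\<close>

text \<open>
  The coordinates of \<open>u\<close> in a finite basis are linear functionals of \<open>u\<close>, so each is an energy
  product with a fixed vector and is bounded by Cauchy--Schwarz.  Measuring the image in the
  ambient norm avoids a triangle inequality for the energy norm.
\<close>

lemma linear_norm_le_energy_norm:
  fixes M :: "'a \<Rightarrow> 'a"
  assumes M: "linear M"
  obtains C where "\<And>u. norm (M u) \<le> C * energy_norm A u"
proof -
  obtain F :: "'a set" where F: "finite F" "span F = UNIV"
    using fin by (auto simp: fin_dim_def)
  obtain D where D: "D \<subseteq> F" "independent D" "F \<subseteq> span D"
    using maximal_independent_subset[of F] by blast
  have finD: "finite D" using D(1) F(1) finite_subset by blast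
  have spD: "u \<in> span D" for u
    using span_minimal[OF D(3) subspace_span] F(2) by auto
  have "linear (\<lambda>u. representation D u b)" for b
    by (intro linearI)
      (simp_all add: representation_add[OF D(2) spD spD] representation_scale[OF D(2) spD])
  then have "\<exists>w. \<forall>u. representation D u b = A u \<bullet> w" for b
    by (metis energy_Riesz)
  then obtain w where w: "\<And>u b. representation D u b = A u \<bullet> w b" by metis
  have "norm (M u) \<le> (\<Sum>b\<in>D. energy_norm A (w b) * norm (M b)) * energy_norm A u" for u
  proof -
    have "M u = M (\<Sum>b\<in>D. representation D u b *\<^sub>R b)"
      using sum_representation_eq[OF D(2) spD finD order_refl, of u] by simp
    also have "\<dots> = (\<Sum>b\<in>D. (A u \<bullet> w b) *\<^sub>R M b)"
      by (simp add: linear_sum[OF M] linear_scale[OF M] w)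
    also have "norm \<dots> \<le> (\<Sum>b\<in>D. \<bar>A u \<bullet> w b\<bar> * norm (M b))"
      by (rule order_trans[OF norm_sum]) simp
    also have "\<dots> \<le> (\<Sum>b\<in>D. (energy_norm A u * energy_norm A (w b)) * norm (M b))"
      by (intro sum_mono mult_right_mono energy_Cauchy_Schwarz) simp
    finally show ?thesis by (simp add: sum_distrib_left mult_ac)
  qed
  then show ?thesis using that by blast
qed

lemma energy_quotients_bdd_above:
  assumes M: "linear M"
  shows "bdd_above (range (\<lambda>u. energy_norm A (M u) / energy_norm A u))"
proof -
  obtain C where C: "\<And>u. norm (M u) \<le> C * energy_norm A u"
    using linear_norm_le_energy_norm[OF M] by blast
  obtain C' where C': "\<And>u. norm ((A \<circ> M) u) \<le> C' * energy_norm A u"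
    using linear_norm_le_energy_norm[OF linear_compose[OF M lin]] by blast
  have "energy_norm A (M u) / energy_norm A u \<le> sqrt \<bar>C' * C\<bar>" for u
  proof -
    have "A (M u) \<bullet> M u \<le> norm (A (M u)) * norm (M u)" by (rule norm_cauchy_schwarz)
    also have "\<dots> \<le> (C' * energy_norm A u) * (C * energy_norm A u)"
      using C[of u] C'[of u] order_trans[OF norm_ge_zero C'[of u]]
      by (intro mult_mono) auto
    also have "\<dots> = (C' * C) * (energy_norm A u)\<^sup>2" by (simp add: power2_eq_square)
    also have "\<dots> \<le> \<bar>C' * C\<bar> * (energy_norm A u)\<^sup>2" by (intro mult_right_mono) auto
    finally have "sqrt (A (M u) \<bullet> M u) \<le> sqrt (\<bar>C' * C\<bar> * (energy_norm A u)\<^sup>2)" by simp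
    then have "energy_norm A (M u) \<le> sqrt \<bar>C' * C\<bar> * energy_norm A u"
      by (simp add: real_sqrt_mult energy_norm_nonneg energy_norm_def[of A "M u"])
    then show ?thesis
      using energy_norm_nonneg[of u]
      by (cases "energy_norm A u = 0") (auto simp: divide_le_eq)
  qed
  then show ?thesis by (intro bdd_aboveI2)
qed

lemma energy_strict_contraction:
  assumes M: "linear M" and less: "energy_onorm A M < 1" and u: "u \<noteq> 0"
  shows "A (M u) \<bullet> M u < A u \<bullet> u"
proof -
  have "energy_norm A (M u) / energy_norm A u \<le> energy_onorm A M"
    unfolding energy_onorm_def by (rule cSUP_upper[OF UNIV_I energy_quotients_bdd_above[OF M]])
  with less have "energy_norm A (M u) / energy_norm A u < 1" by linarith
  then have "energy_norm A (M u) < energy_norm A u"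
    using energy_norm_pos[OF u] by (simp add: divide_less_eq)
  then have "(energy_norm A (M u))\<^sup>2 < (energy_norm A u)\<^sup>2"
    using energy_norm_nonneg by (intro power_strict_mono) auto
  then show ?thesis by (simp add: energy_norm_square)
qed

section \<open>Products and corrections in the energy product\<close>

text \<open>
  Taking adjoints reverses a product, which is why the error operator lists its factors once
  backwards and once forwards.
\<close>

lemma energy_adjoint_op_prod:
  assumes "\<And>k u v. k \<in> set ks \<Longrightarrow> A (N k u) \<bullet> v = A u \<bullet> M k v"
  shows "A (op_prod (map N (rev ks)) u) \<bullet> v = A u \<bullet> op_prod (map M ks) v"
  using assms
proof (induction ks arbitrary: u)
  case Nil
  show ?case by (simp add: op_prod_def)
next
  case (Cons k ks)
  have append: "op_prod (Ms @ [L]) = op_prod Ms \<circ> L" for Ms and L :: "'a \<Rightarrow> 'a"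
    by (induction Ms) (auto simp: op_prod_def)
  have "A (op_prod (map N (rev (k # ks))) u) \<bullet> v = A (op_prod (map N (rev ks)) (N k u)) \<bullet> v"
    by (simp add: append)
  also have "\<dots> = A (N k u) \<bullet> op_prod (map M ks) v"
    using Cons.prems by (intro Cons.IH) auto
  also have "\<dots> = A u \<bullet> op_prod (map M (k # ks)) v"
    using Cons.prems by (simp add: op_prod_def)
  finally show ?case .
qed

text \<open>
  Pairing with \<open>v\<close> in the energy product moves \<open>P\<close> across as \<open>P\<^sup>T\<close>, applied to \<open>A v\<close>; the argument
  that \<open>S\<close> receives is the same expression in \<open>u\<close>, up to the factor \<open>c\<close>.  So a symmetric
  \<open>S\<close> makes the correction symmetric in the energy product, and for \<open>c \<ge> 0\<close> a non-negative \<open>S\<close> keeps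
  the energy form of the correction below that of the identity.
\<close>

lemma energy_correction:
  fixes P :: "'b::real_vector \<Rightarrow> 'a"
  assumes V: "fin_dim_hilbert V ip" and P: "linear_betw V UNIV P"
    and S: "linear_betw V V S"
    and Q: "\<And>v. Q v = c *\<^sub>R adjoint_on V ip (\<bullet>) P v"
  shows "A (correction A P S Q u) \<bullet> v = A u \<bullet> v
    - c * ip (S (adjoint_on V ip (\<bullet>) P (A u))) (adjoint_on V ip (\<bullet>) P (A v))"
proof -
  let ?g = "\<lambda>u. adjoint_on V ip (\<bullet>) P (A u)"
  have H: "inner_product_on (UNIV :: 'a set) (\<bullet>)"
    by (rule inner_product_on_inner)
  note adj = adjoint_on_works[OF V H P UNIV_I]
  have g: "?g u \<in> V" for u by (rule adj(1))
  have Sg: "S (?g u) \<in> V" using linear_betwD(1)[OF S g] .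
  have "A (P (S (Q (A u)))) \<bullet> v = P (S (Q (A u))) \<bullet> A v" by (rule sym)
  also have "\<dots> = (c *\<^sub>R P (S (?g u))) \<bullet> A v"
    using linear_betwD(3)[OF S g] linear_betwD(3)[OF P Sg] by (simp add: Q)
  also have "\<dots> = c * ip (S (?g u)) (?g v)"
    using adj(2)[OF Sg] by simp
  finally show ?thesis
    by (simp add: correction_def linear_diff[OF lin] inner_diff_left)
qed

lemma energy_adjoint_correction:
  fixes P :: "'b::real_vector \<Rightarrow> 'a"
  assumes V: "fin_dim_hilbert V ip" and P: "linear_betw V UNIV P"
    and S: "linear_betw V V S" and T: "linear_betw V V T"
    and Q: "\<And>v. Q v = c *\<^sub>R adjoint_on V ip (\<bullet>) P v"
    and T_adj: "\<And>v. v \<in> V \<Longrightarrow> T v = adjoint_on V ip ip S v"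
  shows "A (correction A P T Q u) \<bullet> v = A u \<bullet> correction A P S Q v"
proof -
  let ?g = "\<lambda>u. adjoint_on V ip (\<bullet>) P (A u)"
  have ip: "inner_product_on V ip" using V by (simp add: fin_dim_hilbert_def)
  have "inner_product_on (UNIV :: 'a set) (\<bullet>)"
    by (rule inner_product_on_inner)
  then have g: "?g u \<in> V" for u using adjoint_on_works(1)[OF V _ P] by blast
  have "ip (T (?g u)) (?g v) = ip (?g v) (T (?g u))"
    using inner_product_onD(1)[OF ip linear_betwD(1)[OF T g] g] .
  also have "\<dots> = ip (S (?g v)) (?g u)"
    using adjoint_on_works(2)[OF V ip S g g] T_adj[OF g] by simp
  finally have "A (correction A P T Q u) \<bullet> v = A (correction A P S Q v) \<bullet> u"
    using energy_correction[OF V P T Q] energy_correction[OF V P S Q] energy_commute[of u v]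
    by simp
  then show ?thesis by (simp add: energy_commute[of u])
qed

lemma linear_correction:
  fixes P :: "'b::real_vector \<Rightarrow> 'a"
  assumes P: "linear_betw V UNIV P" and S: "linear_betw V V S" and Q: "linear_betw UNIV V Q"
  shows "linear (correction A P S Q)"
proof (rule linearI)
  have QV: "Q u \<in> V" for u using linear_betwD(1)[OF Q] by simp
  have SV: "S (Q u) \<in> V" for u using linear_betwD(1)[OF S QV] .
  fix u v :: 'a and r :: real
  show "correction A P S Q (u + v) = correction A P S Q u + correction A P S Q v"
    by (simp add: correction_def linear_add[OF lin] linear_betwD(2)[OF Q]
        linear_betwD(2)[OF S QV QV] linear_betwD(2)[OF P SV SV])
  show "correction A P S Q (r *\<^sub>R u) = r *\<^sub>R correction A P S Q u"
    by (simp add: correction_def linear_scale[OF lin] linear_betwD(3)[OF Q]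
        linear_betwD(3)[OF S QV] linear_betwD(3)[OF P SV] algebra_simps)
qed

section \<open>From the error operator to the preconditioner\<close>

text \<open>
  With \<open>f = A x\<close> and \<open>h = A y\<close> the form \<open>B f \<bullet> h\<close> is the energy product of \<open>B (A x)\<close> and \<open>y\<close>, which is
  what the identity exceeds the error operator by.
\<close>

lemma self_adjoint_pos_def_if_error_small:
  assumes B: "linear B"
    and symm: "\<And>u v. A (u - B (A u)) \<bullet> v = A u \<bullet> (v - B (A v))"
    and small: "\<And>u. u \<noteq> 0 \<Longrightarrow> A (u - B (A u)) \<bullet> u < A u \<bullet> u"
  shows "self_adjoint_on UNIV (\<bullet>) B \<and> pos_def_on UNIV (\<bullet>) B"
proof
  have BA: "A (B (A u)) \<bullet> v = B (A u) \<bullet> A v" for u v by (rule sym)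
  have B_sym: "B f \<bullet> h = f \<bullet> B h" for f h
  proof -
    obtain x y where xy: "f = A x" "h = A y" using surj_A by (metis surj_def)
    have "A (B (A x)) \<bullet> y = A x \<bullet> B (A y)"
      using symm[of x y] by (simp add: linear_diff[OF lin] inner_diff_left inner_diff_right)
    then show ?thesis by (simp add: xy BA)
  qed
  have H: "inner_product_on (UNIV :: 'a set) (\<bullet>)"
    by (rule inner_product_on_inner)
  have "fin_dim_hilbert (UNIV :: 'a set) (\<bullet>)"
    using fin H by (simp add: fin_dim_hilbert_def)
  moreover have "linear_betw UNIV UNIV B"
    using B by (simp add: linear_betw_def linear_add linear_scale)
  ultimately have "B u \<bullet> v = u \<bullet> adjoint_on UNIV (\<bullet>) (\<bullet>) B v" for u v
    using adjoint_on_works(2)[OF _ H] by blast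
  then show "self_adjoint_on UNIV (\<bullet>) B"
    unfolding self_adjoint_on_def by (metis B_sym vector_eq_ldot)
  show "pos_def_on UNIV (\<bullet>) B"
    unfolding pos_def_on_def
  proof (intro ballI impI)
    fix f :: 'a assume f: "f \<noteq> 0"
    obtain x where x: "f = A x" using surj_A by (metis surj_def)
    have "x \<noteq> 0" using f x linear_0[OF lin] by auto
    from small[OF this] show "0 < B f \<bullet> f"
      by (simp add: x linear_diff[OF lin] inner_diff_left flip: BA)
  qed
qed

end

theorem theorem3p3:
  fixes A B :: "'a::real_inner \<Rightarrow> 'a"
    and J :: nat
    and V :: "nat \<Rightarrow> 'b::real_vector set"
    and ip :: "nat \<Rightarrow> 'b \<Rightarrow> 'b \<Rightarrow> real"
    and P :: "nat \<Rightarrow> 'b \<Rightarrow> 'a"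
    and Q :: "nat \<Rightarrow> 'a \<Rightarrow> 'b"
    and R Rbar :: "nat \<Rightarrow> 'b \<Rightarrow> 'b"
    and c :: "nat \<Rightarrow> real"
  assumes H: "fin_dim_hilbert (UNIV :: 'a set) (\<bullet>)"
    and A: "linear A" "self_adjoint_on UNIV (\<bullet>) A" "pos_def_on UNIV (\<bullet>) A"
    and J: "1 \<le> J"
    and V: "\<And>k. k \<le> J \<Longrightarrow> fin_dim_hilbert (V k) (ip k)"
    and P: "\<And>k. k \<le> J \<Longrightarrow> linear_betw (V k) UNIV (P k)"
    and Q: "\<And>k. k \<le> J \<Longrightarrow> linear_betw UNIV (V k) (Q k)"
    and null_P: "\<And>k. k \<in> {1..J} \<Longrightarrow> {u \<in> V k. P k u = 0} = {0}"
    and sum_P: "(UNIV :: 'a set) = (\<Sum>k\<in>{1..J}. P k ` V k)"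
    and R: "\<And>k. k \<le> J \<Longrightarrow> linear_betw (V k) (V k) (R k)"
    and Rbar: "\<And>k. k \<in> {1..J} \<Longrightarrow> linear_betw (V k) (V k) (Rbar k)"
    and B: "linear B"
      "(\<lambda>u. u - B (A u)) =
         op_prod (map (\<lambda>k. correction A (P k) (Rbar k) (Q k)) (rev [1..<Suc J])) \<circ>
         correction A (P 0) (R 0) (Q 0) \<circ>
         op_prod (map (\<lambda>k. correction A (P k) (R k) (Q k)) [1..<Suc J])"
    and Q_adj: "\<And>k. k \<le> J \<Longrightarrow>
      0 < c k \<and> (\<forall>v. Q k v = c k *\<^sub>R adjoint_on (V k) (ip k) (\<bullet>) (P k) v)"
    and Rbar_adj: "\<And>k. k \<in> {1..J} \<Longrightarrow>
      \<forall>v\<in>V k. Rbar k v = adjoint_on (V k) (ip k) (ip k) (R k) v"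
    and R0_adj: "self_adjoint_on (V 0) (ip 0) (R 0)"
    and contraction:
      "energy_onorm A (op_prod (map (\<lambda>k. correction A (P k) (R k) (Q k)) [1..<Suc J])) < 1"
    and R0_nonneg: "nonneg_on (V 0) (ip 0) (R 0)"
  shows "self_adjoint_on UNIV (\<bullet>) B \<and> pos_def_on UNIV (\<bullet>) B"
proof -
  have fin: "fin_dim (UNIV :: 'a set)" and H_ip: "inner_product_on (UNIV :: 'a set) (\<bullet>)"
    using H by (auto simp: fin_dim_hilbert_def)
  have "linear_betw UNIV UNIV A"
    using A(1) by (simp add: linear_betw_def linear_add linear_scale)
  then have A_sym: "A u \<bullet> v = u \<bullet> A v" for u v
    using adjoint_on_works(2)[OF H H_ip _ UNIV_I UNIV_I, of A u v] A(2)
    unfolding self_adjoint_on_def by (metis UNIV_I)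
  interpret energy_space A
    using fin A(1) A_sym A(3) by (intro energy_space.intro) (simp_all add: pos_def_on_def)

  define K where "K k = correction A (P k) (R k) (Q k)" for k
  define Kbar where "Kbar k = correction A (P k) (Rbar k) (Q k)" for k
  define E where "E = op_prod (map K [1..<Suc J])"
  define Estar where "Estar = op_prod (map Kbar (rev [1..<Suc J]))"
  have error: "u - B (A u) = Estar (K 0 (E u))" for u
    using fun_cong[OF B(2), of u]
    unfolding E_def Estar_def K_def[abs_def] Kbar_def[abs_def] by simp
  have Qadj: "Q k v = c k *\<^sub>R adjoint_on (V k) (ip k) (\<bullet>) (P k) v" if "k \<le> J" for k v
    using Q_adj[OF that] by blast

  have "linear (K k)" if "k \<le> J" for k
    unfolding K_def using linear_correction[OF P R Q] that by blast
  then have lin_E: "linear E"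
    unfolding E_def by (intro linear_op_prod) auto
  have E_contr: "A (E u) \<bullet> E u < A u \<bullet> u" if "u \<noteq> 0" for u
    using energy_strict_contraction[OF lin_E _ that] contraction
    unfolding E_def K_def[abs_def] by simp

  have "A (Kbar k u) \<bullet> v = A u \<bullet> K k v" if "k \<in> {1..J}" for k u v
    unfolding K_def Kbar_def
    using energy_adjoint_correction[OF V P R Rbar Qadj] Rbar_adj[OF that] that by simp
  then have Estar_adj: "A (Estar u) \<bullet> v = A u \<bullet> E v" for u v
    unfolding E_def Estar_def by (intro energy_adjoint_op_prod) auto
  have K0_sym: "A (K 0 u) \<bullet> v = A u \<bullet> K 0 v" for u v
    unfolding K_def
    using energy_adjoint_correction[OF V P R R Qadj] R0_adj by (simp add: self_adjoint_on_def)

  have K0_le: "A (K 0 u) \<bullet> u \<le> A u \<bullet> u" for u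
  proof -
    let ?g = "adjoint_on (V 0) (ip 0) (\<bullet>) (P 0) (A u)"
    have "?g \<in> V 0" using adjoint_on_works(1)[OF V H_ip P UNIV_I] by simp
    then have "0 \<le> c 0 * ip 0 (R 0 ?g) ?g"
      using R0_nonneg Q_adj[of 0] by (simp add: nonneg_on_def)
    then show ?thesis
      unfolding K_def using energy_correction[OF V P R Qadj, of 0 u u] by simp
  qed

  show ?thesis
  proof (rule self_adjoint_pos_def_if_error_small[OF B(1)])
    fix u v
    have "A (Estar (K 0 (E u))) \<bullet> v = A (E u) \<bullet> K 0 (E v)"
      by (simp add: Estar_adj K0_sym)
    also have "\<dots> = A (Estar (K 0 (E v))) \<bullet> u"
      by (simp add: Estar_adj energy_commute[of "K 0 (E v)"])
    finally show "A (u - B (A u)) \<bullet> v = A u \<bullet> (v - B (A v))"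
      by (simp add: error energy_commute[of u])
  next
    fix u :: 'a assume "u \<noteq> 0"
    have "A (Estar (K 0 (E u))) \<bullet> u \<le> A (E u) \<bullet> E u"
      using K0_le by (simp add: Estar_adj)
    also have "\<dots> < A u \<bullet> u" using E_contr[OF \<open>u \<noteq> 0\<close>] .
    finally show "A (u - B (A u)) \<bullet> u < A u \<bullet> u" by (simp add: error)
  qed
qed

end
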